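(* Let $\gamma:\mathbb{Z}\to\operatorname{Im}(\mathbb{H})\cong\mathbb{R}^3$ be a regular arc-length parametrized discrete curve with edges $u=\gamma_1-\gamma$. Then $\gamma$ is a $2$-invariant curve if and only if it stays invariant under a combination of tangent and Hashimoto flow (i.e. it is a discrete elastic rod), that is, if and only if there exist constants $(\alpha,\beta)\in\mathbb{R}^2\setminus\{(0,0)\}$ and $e,x\in\mathbb{R}^3$ such that at every vertex $$2\alpha F^T+\beta F^H=e\times\gamma+x,$$ where $$F^T=\frac{u_{\bar1}+u}{1+\langle u_{\bar1},u\rangle},\qquad F^H=2\,\frac{u_{\bar1}\times u}{1+\langle u_{\bar1},u\rangle}.$$
   Context: Write $\gamma=\gamma(k)$, $\gamma_1=\gamma(k+1)$, $\gamma_{\bar1}=\gamma(k-1)$, $u=u(k)=\gamma(k+1)-\gamma(k)$, $u_{\bar1}=u(k-1)$. $\mathbb{H}$ denotes the quaternions, $\mathbb{S}^2=\{p\in\mathbb{H}:p^2=-1\}$ the imaginary unit quaternions, and $\vec q=\operatorname{Im}(q)$. The curve is arc-length parametrized if $|u|=1$ everywhere and regular if $\gamma_{\bar1}\neq\gamma_1$ everywhere. A Bäcklund transformation of a curve with edges $u(k)\in\mathbb{S}^2$ is given by quaternions $v(k)\in\mathbb{H}\setminus\mathbb{S}^2$ and a curve with edges $\tilde u(k)\in\mathbb{S}^2$ such that $u(k)+v(k+1)=v(k)+\tilde u(k)$ and $v(k+1)u(k)=\tilde u(k)v(k)$ for all $k$. A regular arc-length parametrized curve $\gamma$ is $2$-invariant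 if there is a sequence of two Bäcklund transformations, with quaternions $v(k,0)$ and $v(k,1)$, such that the second transform $\tilde\gamma$, with edges $\tilde u$, is related to $\gamma$ by a Euclidean motion, acting on edges as a rotation $u=E\tilde uE^{-1}$ with some $E\in\mathbb{H}\setminus\{0\}$, and such that the matrix $$M(k)=\begin{pmatrix}E&0\\0&E\end{pmatrix}\begin{pmatrix}v(k,1)&1\\-1&v(k,1)\end{pmatrix}\begin{pmatrix}v(k,0)&1\\-1&v(k,0)\end{pmatrix}=\begin{pmatrix}A&B\\-B&A\end{pmatrix}$$ does not act as the identity on $\mathbb{S}^2$ via $u\mapsto(A-Bu)u(A-Bu)^{-1}$, i.e. $(\vec A,\vec B)\neq(0,0)$. *)

theory Defs
  imports "HOL-Analysis.Analysis"
begin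

text \<open>A quaternion is a pair of a real part and an imaginary part in \<open>\<real>\<^sup>3\<close>, with product
  \<open>(a + v)(b + w) = (ab - \<langle>v, w\<rangle>) + (a w + b v + v \<times> w)\<close>.\<close>

datatype quat = Quat (qRe: real) (qIm: "real^3")

instantiation quat :: real_div_algebra
begin

definition "0 = Quat 0 0"
definition "1 = Quat 1 0"
definition "p + q = Quat (qRe p + qRe q) (qIm p + qIm q)"
definition "- p = Quat (- qRe p) (- qIm p)"
definition "p - q = Quat (qRe p - qRe q) (qIm p - qIm q)"
definition "r *\<^sub>R p = Quat (r * qRe p) (r *\<^sub>R qIm p)"
definition "p * q =
  Quat (qRe p * qRe q - qIm p \<bullet> qIm q)
       (qRe p *\<^sub>R qIm q + qRe q *\<^sub>R qIm p + cross3 (qIm p) (qIm q))"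
definition "inverse p =
  (1 / ((qRe p)\<^sup>2 + qIm p \<bullet> qIm p)) *\<^sub>R Quat (qRe p) (- qIm p)"
definition "p div q = p * inverse (q :: quat)"

instance
proof
  fix a b c :: quat and r s :: real
  show "a * b * c = a * (b * c)"
    by (cases a; cases b; cases c)
       (simp add: times_quat_def cross3_simps forall_3)
  show "(a + b) * c = a * c + b * c" "a * (b + c) = a * b + a * c"
    by (cases a; cases b; cases c; simp add: times_quat_def plus_quat_def cross3_simps)+
  show "inverse a * a = 1" "a * inverse a = 1" if "a \<noteq> 0"
  proof -
    obtain x y where a: "a = Quat x y" by (cases a)
    have n: "x\<^sup>2 + y \<bullet> y \<noteq> 0"
      using that by (auto simp: a zero_quat_def add_nonneg_eq_0_iff)
    have "x * x / (x\<^sup>2 + y \<bullet> y) + (y \<bullet> y) / (x\<^sup>2 + y \<bullet> y) = 1"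
      using n by (simp add: power2_eq_square flip: add_divide_distrib)
    then show "inverse a * a = 1" "a * inverse a = 1"
      by (simp_all add: a times_quat_def inverse_quat_def one_quat_def scaleR_quat_def
          cross_mult_left cross_mult_right)
  qed
qed (simp_all add: zero_quat_def one_quat_def plus_quat_def uminus_quat_def minus_quat_def
      scaleR_quat_def times_quat_def inverse_quat_def divide_quat_def cross_mult_left
      cross_mult_right algebra_simps)

end

definition quat_of_vec :: "real^3 \<Rightarrow> quat" where
  "quat_of_vec w = Quat 0 w"

definition imag_sphere :: "quat set" where
  "imag_sphere = {p. p\<^sup>2 = -1}"


definition edge :: "(int \<Rightarrow> real^3) \<Rightarrow> int \<Rightarrow> real^3" where
  "edge \<gamma> k = \<gamma> (k + 1) - \<gamma> k"

definition qedge :: "(int \<Rightarrow> real^3) \<Rightarrow> int \<Rightarrow> quat" where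
  "qedge \<gamma> k = quat_of_vec (edge \<gamma> k)"

definition arc_length_param :: "(int \<Rightarrow> real^3) \<Rightarrow> bool" where
  "arc_length_param \<gamma> \<longleftrightarrow> (\<forall>k. norm (edge \<gamma> k) = 1)"

definition regular_curve :: "(int \<Rightarrow> real^3) \<Rightarrow> bool" where
  "regular_curve \<gamma> \<longleftrightarrow> (\<forall>k. \<gamma> (k - 1) \<noteq> \<gamma> (k + 1))"

definition tangent_flow :: "(int \<Rightarrow> real^3) \<Rightarrow> int \<Rightarrow> real^3" where
  "tangent_flow \<gamma> k =
    (1 / (1 + edge \<gamma> (k - 1) \<bullet> edge \<gamma> k)) *\<^sub>R (edge \<gamma> (k - 1) + edge \<gamma> k)"

definition hashimoto_flow :: "(int \<Rightarrow> real^3) \<Rightarrow> int \<Rightarrow> real^3" where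
  "hashimoto_flow \<gamma> k =
    (2 / (1 + edge \<gamma> (k - 1) \<bullet> edge \<gamma> k)) *\<^sub>R cross3 (edge \<gamma> (k - 1)) (edge \<gamma> k)"


text \<open>The transform need not be regular.\<close>

definition baecklund :: "(int \<Rightarrow> real^3) \<Rightarrow> (int \<Rightarrow> quat) \<Rightarrow> (int \<Rightarrow> real^3) \<Rightarrow> bool" where
  "baecklund \<gamma> v \<eta> \<longleftrightarrow>
    (\<forall>k. v k \<notin> imag_sphere \<and> qedge \<gamma> k \<in> imag_sphere \<and> qedge \<eta> k \<in> imag_sphere \<and>
         qedge \<gamma> k + v (k + 1) = v k + qedge \<eta> k \<and>
         v (k + 1) * qedge \<gamma> k = qedge \<eta> k * v k)"

definition cmat :: "quat \<Rightarrow> quat \<Rightarrow> quat^2^2" where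
  "cmat p q = vector [vector [p, q], vector [- q, p]]"

definition monodromy :: "quat \<Rightarrow> quat \<Rightarrow> quat \<Rightarrow> quat^2^2" where
  "monodromy E v1 v0 = cmat E 0 ** cmat v1 1 ** cmat v0 1"

definition sphere_action :: "quat^2^2 \<Rightarrow> quat \<Rightarrow> quat" where
  "sphere_action M u =
    (let A = M $ 1 $ 1; B = M $ 1 $ 2 in (A - B * u) * u * inverse (A - B * u))"

definition acts_as_identity :: "quat^2^2 \<Rightarrow> bool" where
  "acts_as_identity M \<longleftrightarrow> (\<forall>u\<in>imag_sphere. sphere_action M u = u)"

text \<open>The Euclidean motion is \<open>p \<mapsto> E p E\<^sup>-\<^sup>1 + c\<close>; on edges it acts by the rotation
  \<open>u = E \<tilde>u E\<^sup>-\<^sup>1\<close>. The non-degeneracy condition is imposed at every vertex.\<close>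

definition two_invariant :: "(int \<Rightarrow> real^3) \<Rightarrow> bool" where
  "two_invariant \<gamma> \<longleftrightarrow>
    (\<exists>v0 v1 \<gamma>' \<gamma>'' E c.
       baecklund \<gamma> v0 \<gamma>' \<and> baecklund \<gamma>' v1 \<gamma>'' \<and> E \<noteq> 0 \<and>
       (\<forall>k. quat_of_vec (\<gamma> k) = E * quat_of_vec (\<gamma>'' k) * inverse E + quat_of_vec c) \<and>
       (\<forall>k. \<not> acts_as_identity (monodromy E (v1 k) (v0 k))))"


lemma quat_eq_iff: "p = q \<longleftrightarrow> qRe p = qRe q \<and> qIm p = qIm q"
  by (cases p; cases q) simp

lemma quat_sel [simp]:
  "qRe 0 = 0" "qIm 0 = 0" "qRe 1 = 1" "qIm 1 = 0"
  "qRe (p + q) = qRe p + qRe q" "qIm (p + q) = qIm p + qIm q"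
  "qRe (- p) = - qRe p" "qIm (- p) = - qIm p"
  "qRe (p - q) = qRe p - qRe q" "qIm (p - q) = qIm p - qIm q"
  "qRe (r *\<^sub>R p) = r * qRe p" "qIm (r *\<^sub>R p) = r *\<^sub>R qIm p"
  "qRe (p * q) = qRe p * qRe q - qIm p \<bullet> qIm q"
  "qIm (p * q) = qRe p *\<^sub>R qIm q + qRe q *\<^sub>R qIm p + cross3 (qIm p) (qIm q)"
  "qRe (quat_of_vec w) = 0" "qIm (quat_of_vec w) = w"
  by (simp_all add: zero_quat_def one_quat_def plus_quat_def uminus_quat_def minus_quat_def
      scaleR_quat_def times_quat_def quat_of_vec_def)

lemma imag_sphere_iff: "p \<in> imag_sphere \<longleftrightarrow> qRe p = 0 \<and> norm (qIm p) = 1"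
proof
  assume "p \<in> imag_sphere"
  then have re: "qRe p * qRe p - qIm p \<bullet> qIm p = -1" and "(2 * qRe p) *\<^sub>R qIm p = 0"
    by (simp_all add: imag_sphere_def power2_eq_square quat_eq_iff scaleR_2 flip: scaleR_scaleR)
  then have "qRe p = 0 \<or> qIm p = 0" by simp
  moreover have "qIm p \<noteq> 0"
  proof
    assume "qIm p = 0"
    then have "qRe p * qRe p = -1" using re by simp
    then show False using zero_le_square[of "qRe p"] by linarith
  qed
  ultimately show "qRe p = 0 \<and> norm (qIm p) = 1"
    using re by (simp add: norm_eq_1)
qed (simp add: imag_sphere_def power2_eq_square quat_eq_iff norm_eq_1)

lemma monodromy_nth [simp]:
  "monodromy E v1 v0 $ 1 $ 1 = E * (v1 * v0 - 1)" "monodromy E v1 v0 $ 1 $ 2 = E * (v1 + v0)"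
  "monodromy E v1 v0 $ 2 $ 1 = - (E * (v1 + v0))" "monodromy E v1 v0 $ 2 $ 2 = E * (v1 * v0 - 1)"
  by (simp_all add: monodromy_def cmat_def matrix_matrix_mult_def sum_2 algebra_simps)

text \<open>The matrix acts as the identity exactly when \<open>A\<close> and \<open>B\<close> are both real.\<close>

lemma acts_as_identity_monodromy_iff:
  assumes "E \<noteq> 0" "v0 \<notin> imag_sphere"
  shows "acts_as_identity (monodromy E v1 v0) \<longleftrightarrow>
    qIm (monodromy E v1 v0 $ 1 $ 1) = 0 \<and> qIm (monodromy E v1 v0 $ 1 $ 2) = 0"
proof -
  define A B where AB: "A = monodromy E v1 v0 $ 1 $ 1" "B = monodromy E v1 v0 $ 1 $ 2"
  define a b where ab: "a = qIm A" "b = qIm B"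
  have nz: "A \<noteq> 0 \<or> B \<noteq> 0"
  proof (rule ccontr)
    assume "\<not> ?thesis"
    then have "v1 * v0 = 1" "v1 + v0 = 0" using assms(1) by (simp_all add: AB)
    then have "v0\<^sup>2 = -1"
      by (metis add_eq_0_iff2 minus_mult_left minus_minus power2_eq_square)
    then show False using assms(2) by (simp add: imag_sphere_def)
  qed
  have act: "sphere_action (monodromy E v1 v0) u = (A - B * u) * u * inverse (A - B * u)" for u
    by (simp add: sphere_action_def Let_def AB)
  have double: "x = 0" if "x + x = 0" for x :: "real^3"
    using that by (simp add: vec_eq_iff)
  have "a = 0 \<and> b = 0" if id: "acts_as_identity (monodromy E v1 v0)"
  proof -
    have *: "cross3 a w = cross3 (cross3 b w) w" if w: "norm w = 1" for w
    proof -
      let ?u = "quat_of_vec w"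
      let ?P = "A - B * ?u"
      have u: "?u \<in> imag_sphere" using w by (simp add: imag_sphere_iff)
      then have eq: "?P * ?u * inverse ?P = ?u" using id by (simp add: acts_as_identity_def act)
      have "?u \<noteq> 0" using w by (auto simp: quat_eq_iff)
      then have "?P \<noteq> 0" using eq by auto
      then have "?P * ?u = ?u * ?P"
        using arg_cong[OF eq, of "\<lambda>x. x * ?P"] by (simp add: mult.assoc)
      then have "qIm (?P * ?u) = qIm (?u * ?P)" by simp
      then have "cross3 (qIm ?P) w = cross3 w (qIm ?P)" by simp
      then have "cross3 (qIm ?P) w + cross3 (qIm ?P) w = 0"
        using cross_skew[of w "qIm ?P"] by (metis add.right_inverse)
      then have "cross3 (qIm ?P) w = 0" by (rule double)
      moreover have "cross3 (qIm ?P) w = cross3 a w - cross3 (cross3 b w) w"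
        by (simp add: ab Cross3.left_diff_distrib cross_add_left cross_mult_left)
      ultimately show ?thesis by simp
    qed
    have "cross3 a w = 0 \<and> cross3 (cross3 b w) w = 0" if w: "norm w = 1" for w
    proof -
      have "cross3 a w = cross3 (cross3 b w) w" "- cross3 a w = cross3 (cross3 b w) w"
        using *[OF w] *[of "- w"] w by simp_all
      then have "cross3 a w + cross3 a w = 0" by (metis add.right_inverse)
      then show ?thesis using double *[OF w] by metis
    qed
    then have **: "cross3 a (axis i 1) = 0" "cross3 (cross3 b (axis i 1)) (axis i 1) = 0" for i
      by (simp_all add: norm_axis_1)
    show ?thesis
      using **[of 1] **[of 2] **[of 3]
      by (simp add: cross3_simps axis_def forall_3)
  qed
  moreover have "acts_as_identity (monodromy E v1 v0)" if "a = 0 \<and> b = 0"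
    unfolding acts_as_identity_def
  proof
    fix u assume u: "u \<in> imag_sphere"
    let ?P = "A - B * u"
    have comm: "?P * u = u * ?P"
      using that by (simp add: ab quat_eq_iff cross_mult_left cross_mult_right algebra_simps)
    have "?P \<noteq> 0"
    proof
      assume P: "?P = 0"
      have u0: "qRe u = 0" using u by (simp add: imag_sphere_iff)
      have u1: "qIm u \<noteq> 0" using u by (auto simp: imag_sphere_iff)
      have A: "qIm A = 0" and B: "qIm B = 0" using that by (simp_all add: ab)
      have "qIm ?P = 0" "qRe ?P = 0" by (simp_all only: P quat_sel)
      then have "- (qRe B *\<^sub>R qIm u) = 0" "qRe A = 0"
        by (simp_all only: quat_sel A B u0) simp_all
      then have "qRe B = 0" "qRe A = 0" using u1 by simp_all
      then have "A = 0" "B = 0" using A B by (simp_all add: quat_eq_iff)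
      then show False using nz by simp
    qed
    then have "?P * inverse ?P = 1" by (rule right_inverse)
    then show "sphere_action (monodromy E v1 v0) u = u"
      unfolding act comm mult.assoc[of u] by (simp only: mult_1_right)
  qed
  ultimately show ?thesis unfolding ab AB by blast
qed

end

theory Submission
  imports Defs
begin

text \<open>
  The Baecklund relations say \<open>(v' + \<lambda>)(u + \<lambda>) = (\<tilde>u + \<lambda>)(v + \<lambda>)\<close> for all central \<open>\<lambda>\<close>, so two
  transformations closed up by \<open>E\<close> make \<open>E (v\<^sub>1 + \<lambda>)(v\<^sub>0 + \<lambda>) = E \<lambda>\<^sup>2 + B \<lambda> + C\<close> intertwine
  \<open>u + \<lambda>\<close> between consecutive vertices. Put \<open>A = C - E\<close> and let \<open>a, b\<close> be the imaginary parts of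
  \<open>A, B\<close>. Comparing coefficients, \<open>P = \<langle>a, u\<rangle>\<close> and \<open>Q = \<langle>b, u\<rangle>\<close> are constant, \<open>a, b\<close> at a
  vertex are determined by \<open>P, Q\<close> and the two adjacent edges, with \<open>b = Q F\<^sup>T - (P / 2) F\<^sup>H\<close>, and
  \<open>b' - b = 2 u \<times> Im E\<close> makes \<open>b\<close> an infinitesimal Euclidean motion.

  Conversely, a rod determines \<open>a, b\<close> and the imaginary part of \<open>E\<close>, while the real parts of
  \<open>E, B, C\<close> are free. Those of \<open>B\<close> and \<open>C - 4 E\<close> are chosen by a complex square root so that the
  polynomial at one vertex has a right factor \<open>v\<^sub>0 + \<lambda>\<close> with \<open>v\<^sub>0\<^sup>2 = -4\<close>, i.e. \<open>B v\<^sub>0 = C - 4 E\<close>;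
  the factor propagates along the curve by conjugation. A large real part of \<open>E\<close> keeps the other
  factor off the sphere of imaginary units.
\<close>

section \<open>Vector algebra at a single vertex\<close>

lemma cross_cross_unit:
  fixes u a :: "real^3"
  assumes "u \<bullet> u = 1"
  shows "cross3 (cross3 u a) u = a - (a \<bullet> u) *\<^sub>R u"
    and "cross3 u (cross3 a u) = a - (a \<bullet> u) *\<^sub>R u"
    and "cross3 u (cross3 u a) = (a \<bullet> u) *\<^sub>R u - a"
    and "cross3 (cross3 a u) u = (a \<bullet> u) *\<^sub>R u - a"
  using assms Lagrange[of u a u] Lagrange[of u u a] cross_skew[of "cross3 u a" u]
    cross_skew[of "cross3 a u" u]
  by (simp_all add: inner_commute)

text \<open>Both expressions for \<open>b\<close> can also be solved for \<open>a\<close>. Inner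
  products with \<open>p\<close> and \<open>u\<close> then give, for either claim, two equations
  \<open>y = x * (p \<bullet> u) + d\<close> and \<open>x = y * (p \<bullet> u) + d\<close>, whose
  difference is \<open>(x - y) * (1 + p \<bullet> u) = 0\<close>.\<close>

lemma vertex_const:
  fixes p u a b :: "real^3"
  assumes p: "p \<bullet> p = 1" and u: "u \<bullet> u = 1" and nz: "1 + p \<bullet> u \<noteq> 0"
    and bu: "b = s *\<^sub>R u + cross3 u a" and bp: "b = t *\<^sub>R p - cross3 p a"
  shows "s = t" "a \<bullet> u = a \<bullet> p"
proof -
  have au: "a = (a \<bullet> u) *\<^sub>R u + cross3 b u"
    unfolding bu using cross_cross_unit[OF u, of a] by (simp add: cross_add_left cross_mult_left)
  have ap: "a = (a \<bullet> p) *\<^sub>R p - cross3 b p"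
    unfolding bp using cross_cross_unit[OF p, of a]
    by (simp add: Cross3.left_diff_distrib cross_mult_left)
  have eqI: "x = y" if "y = x * (p \<bullet> u) + d" "x = y * (p \<bullet> u) + d" for x y d
  proof -
    have "(x - y) * (1 + p \<bullet> u) = 0" using that by (simp add: algebra_simps)
    then show ?thesis using nz by simp
  qed
  have "b \<bullet> u = s" "b \<bullet> p = t"
    using p u bu bp by (metis dot_cross_self inner_add_left inner_diff_left
      inner_scaleR_left add.right_neutral diff_zero mult.right_neutral inner_commute)+
  moreover have "b \<bullet> p = s * (p \<bullet> u) + cross3 u a \<bullet> p"
    by (subst bu) (simp add: inner_add_left inner_commute[of u p])
  moreover have "b \<bullet> u = t * (p \<bullet> u) - cross3 p a \<bullet> u"
    by (subst bp) (simp add: inner_diff_left)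
  moreover have "cross3 p a \<bullet> u = - (cross3 u a \<bullet> p)" 
    by (simp add: cross3_simps)
  ultimately show "s = t" by - (rule eqI[where d = "cross3 u a \<bullet> p"]; simp)
  have "a \<bullet> p = (a \<bullet> u) * (p \<bullet> u) + cross3 b u \<bullet> p"
    by (subst au) (simp add: inner_add_left inner_commute[of u p])
  moreover have "a \<bullet> u = (a \<bullet> p) * (p \<bullet> u) - cross3 b p \<bullet> u"
    by (subst ap) (simp add: inner_diff_left)
  moreover have "cross3 b p \<bullet> u = - (cross3 b u \<bullet> p)" 
    by (simp add: cross3_simps)
  ultimately show "a \<bullet> u = a \<bullet> p" by - (rule eqI[where d = "cross3 b u \<bullet> p"]; simp)
qed

text \<open>Crossing the two expressions for \<open>b\<close> with \<open>u\<close> and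
  \<open>p\<close> and adding eliminates \<open>a\<close>: what remains is
  \<open>cross3 b (p + u) = P *\<^sub>R (p - u)\<close>. Crossing once more with
  \<open>p + u\<close> isolates \<open>b\<close>, because its inner product with
  \<open>p + u\<close> is \<open>2 * Q\<close>.\<close>

lemma vertex_unique:
  fixes p u a b :: "real^3"
  assumes p: "p \<bullet> p = 1" and u: "u \<bullet> u = 1"
    and bu: "b = Q *\<^sub>R u + cross3 u a" and bp: "b = Q *\<^sub>R p - cross3 p a"
    and au: "a \<bullet> u = P" and ap: "a \<bullet> p = P"
  shows "(1 + p \<bullet> u) *\<^sub>R b = Q *\<^sub>R (p + u) - P *\<^sub>R cross3 p u"
proof -
  have "cross3 b u = a - P *\<^sub>R u"
    unfolding bu using au cross_cross_unit[OF u, of a] by (simp add: cross_add_left cross_mult_left)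
  moreover have "cross3 b p = P *\<^sub>R p - a"
    unfolding bp using ap cross_cross_unit[OF p, of a]
    by (simp add: Cross3.left_diff_distrib cross_mult_left)
  ultimately have "cross3 b (p + u) = P *\<^sub>R (p - u)"
    by (simp add: cross_add_right algebra_simps)
  then have "cross3 (p + u) (cross3 b (p + u)) = P *\<^sub>R cross3 (p + u) (p - u)"
    by (simp add: cross_mult_right)
  moreover have "cross3 (p + u) (p - u) = (-2) *\<^sub>R cross3 p u"
    using cross_skew[of u p]
    by (simp add: cross_add_left Cross3.right_diff_distrib scaleR_2)
  moreover have "b \<bullet> u = Q" using u by (simp add: bu inner_add_left dot_cross_self)
  moreover have "b \<bullet> p = Q" using p by (simp add: bp inner_diff_left dot_cross_self)
  ultimately have "(2 + 2 * (p \<bullet> u)) *\<^sub>R b - (2 * Q) *\<^sub>R (p + u) = (- 2 * P) *\<^sub>R cross3 p u"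
    using p u
    by (simp add: Lagrange inner_add_left inner_add_right inner_commute mult.commute add.commute)
  then have "2 *\<^sub>R ((1 + p \<bullet> u) *\<^sub>R b) = 2 *\<^sub>R (Q *\<^sub>R (p + u) - P *\<^sub>R cross3 p u)"
    by (simp add: algebra_simps)
  then show ?thesis by (simp only: scaleR_cancel_left) simp
qed

text \<open>The formula found in \<open>vertex_unique\<close> does solve the vertex equations. The
  substitution of \<open>(Q, -P)\<close> for \<open>(P, Q)\<close> turns \<open>a\<close> into
  \<open>b\<close> and \<open>b\<close> into \<open>-a\<close>, which explains the paired
  conclusions.\<close>

lemma vertex_exists:
  fixes p u :: "real^3" and P Q :: real
  assumes p: "p \<bullet> p = 1" and u: "u \<bullet> u = 1" and nz: "1 + p \<bullet> u \<noteq> 0"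
  defines "a \<equiv> (1 / (1 + p \<bullet> u)) *\<^sub>R (P *\<^sub>R (p + u) + Q *\<^sub>R cross3 p u)"
    and "b \<equiv> (1 / (1 + p \<bullet> u)) *\<^sub>R (Q *\<^sub>R (p + u) - P *\<^sub>R cross3 p u)"
  shows "a \<bullet> u = P" "a \<bullet> p = P" "b \<bullet> u = Q" "b \<bullet> p = Q"
    and "b = Q *\<^sub>R u + cross3 u a" "b = Q *\<^sub>R p - cross3 p a"
    and "a = P *\<^sub>R u + cross3 b u" "a = P *\<^sub>R p - cross3 b p"
proof -
  have 1: "(1 + p \<bullet> u) *\<^sub>R a = P *\<^sub>R (p + u) + Q *\<^sub>R cross3 p u"
    and 2: "(1 + p \<bullet> u) *\<^sub>R b = Q *\<^sub>R (p + u) - P *\<^sub>R cross3 p u"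
    using nz by (simp_all add: a_def b_def)
  show au: "a \<bullet> u = P" and ap: "a \<bullet> p = P" and "b \<bullet> u = Q" "b \<bullet> p = Q"
    using nz p u arg_cong[OF 1, of "\<lambda>x. x \<bullet> u"] arg_cong[OF 1, of "\<lambda>x. x \<bullet> p"]
      arg_cong[OF 2, of "\<lambda>x. x \<bullet> u"] arg_cong[OF 2, of "\<lambda>x. x \<bullet> p"]
    by (simp_all add: inner_add_left inner_diff_left dot_cross_self inner_commute[of u p]
        add.commute[of "p \<bullet> u"] mult.commute[of P] mult.commute[of Q])
  have "(1 + p \<bullet> u) *\<^sub>R (Q *\<^sub>R u + cross3 u a)
    = (1 + p \<bullet> u) *\<^sub>R (Q *\<^sub>R u) + cross3 u ((1 + p \<bullet> u) *\<^sub>R a)"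
    by (simp add: cross_mult_right scaleR_add_right)
  also have "\<dots> = (1 + p \<bullet> u) *\<^sub>R b"
    unfolding 1 2
    by (simp add: cross_add_right cross_mult_right cross_cross_unit(2)[OF u] cross_skew[of u p])
      (simp add: algebra_simps)
  finally show bu: "b = Q *\<^sub>R u + cross3 u a" using nz by simp
  have "(1 + p \<bullet> u) *\<^sub>R (Q *\<^sub>R p - cross3 p a)
    = (1 + p \<bullet> u) *\<^sub>R (Q *\<^sub>R p) - cross3 p ((1 + p \<bullet> u) *\<^sub>R a)"
    by (simp add: cross_mult_right scaleR_diff_right)
  also have "\<dots> = (1 + p \<bullet> u) *\<^sub>R b"
    unfolding 1 2
    by (simp add: cross_add_right cross_mult_right cross_cross_unit(3)[OF p] inner_commute)
      (simp add: algebra_simps)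
  finally show bp: "b = Q *\<^sub>R p - cross3 p a" using nz by simp
  show "a = P *\<^sub>R u + cross3 b u"
    unfolding bu using au cross_cross_unit[OF u, of a] by (simp add: cross_add_left cross_mult_left)
  show "a = P *\<^sub>R p - cross3 b p"
    unfolding bp using ap cross_cross_unit[OF p, of a]
    by (simp add: Cross3.left_diff_distrib cross_mult_left)
qed

section \<open>Intertwining quadratic polynomials\<close>

text \<open>The coefficients of the polynomial identity
  \<open>(E \<lambda>\<^sup>2 + B' \<lambda> + C')(u + \<lambda>) = (u + \<lambda>)(E \<lambda>\<^sup>2 + B \<lambda> + C)\<close>.\<close>

definition intertwines :: "quat \<Rightarrow> quat \<Rightarrow> quat \<Rightarrow> quat \<Rightarrow> quat \<Rightarrow> quat \<Rightarrow> bool" where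
  "intertwines E u B C B' C' \<longleftrightarrow>
    B' + E * u = u * E + B \<and> C' + B' * u = C + u * B \<and> C' * u = u * C"

text \<open>Real parts of the three relations give the inner products and show that \<open>B\<close>
  and \<open>C\<close> keep their real parts. Subtracting \<open>E\<close> from \<open>C\<close>
  makes \<open>E\<close> drop out of the constant coefficient, which becomes
  \<open>cross3 a' w - cross3 w a = b' - b\<close>.\<close>

lemma intertwines_vec:
  assumes I: "intertwines E u B C B' C'" and u: "u \<in> imag_sphere"
  defines "a \<equiv> qIm (C - E)" and "a' \<equiv> qIm (C' - E)" and "b \<equiv> qIm B" and "b' \<equiv> qIm B'"
    and "w \<equiv> qIm u"
  shows "a' \<bullet> w = a \<bullet> w" "b' \<bullet> w = b \<bullet> w"
    and "b = (b \<bullet> w) *\<^sub>R w + cross3 w a" "b' = (b \<bullet> w) *\<^sub>R w - cross3 w a'"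
    and "b' - b = 2 *\<^sub>R cross3 w (qIm E)"
proof -
  have u0: "qRe u = 0" and ww: "w \<bullet> w = 1"
    using u by (simp_all add: imag_sphere_iff w_def norm_eq_1)
  have R1: "B' + E * u = u * E + B" and R2: "C' + B' * u = C + u * B" and R3: "C' * u = u * C"
    using I by (auto simp: intertwines_def)
  have B0: "qRe B' = qRe B"
    using arg_cong[OF R1, of qRe] by (simp add: u0 inner_commute)
  show d: "b' - b = 2 *\<^sub>R cross3 w (qIm E)"
    using arg_cong[OF R1, of qIm] cross_skew[of "qIm E" w]
    by (simp add: u0 b_def b'_def w_def scaleR_2 algebra_simps)
  have "w \<bullet> (b' - b) = 0" unfolding d by (simp add: dot_cross_self)
  then show bw: "b' \<bullet> w = b \<bullet> w" by (simp add: inner_commute inner_diff_right)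
  show aw: "a' \<bullet> w = a \<bullet> w"
    using arg_cong[OF R3, of qRe] by (simp add: u0 a_def a'_def w_def inner_diff_left inner_commute[of "qIm u"])
  have C0: "qRe C' = qRe C"
    using arg_cong[OF R2, of qRe] bw by (simp add: u0 b_def b'_def w_def inner_commute)
  have I: "a' + cross3 b' w = a + cross3 w b"
    using arg_cong[OF R2, of qIm] B0 by (simp add: u0 a_def a'_def b_def b'_def w_def)
  have II: "cross3 a' w - cross3 w a = b' - b"
    using arg_cong[OF R3, of qIm] C0 cross_skew[of "qIm E" w] unfolding d
    by (simp add: u0 a_def a'_def w_def scaleR_2 Cross3.left_diff_distrib
        Cross3.right_diff_distrib algebra_simps)
  \<comment> \<open>Crossing \<open>I\<close> with \<open>w\<close> yields the sum of the two
    products whose difference is \<open>II\<close>; sum and difference together determine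
    \<open>b\<close> and \<open>b'\<close>.\<close>
  have "cross3 a' w + cross3 (cross3 b' w) w = cross3 a w + cross3 (cross3 w b) w"
    using arg_cong[OF I, of "\<lambda>x. cross3 x w"] by (simp add: cross_add_left)
  then have III: "cross3 a' w + cross3 w a = b + b' - 2 *\<^sub>R ((b \<bullet> w) *\<^sub>R w)"
    unfolding cross_cross_unit[OF ww] bw cross_skew[of a w] scaleR_2 by (simp add: algebra_simps)
  have *: "2 *\<^sub>R y = 2 *\<^sub>R (t + x)" "2 *\<^sub>R z = 2 *\<^sub>R (t + p)"
    if "p - x = z - y" "p + x = y + z - 2 *\<^sub>R t" for p t x y z :: "real^3"
  proof -
    have z: "z = p - x + y" using that(1) by (simp add: algebra_simps)
    show "2 *\<^sub>R y = 2 *\<^sub>R (t + x)" "2 *\<^sub>R z = 2 *\<^sub>R (t + p)"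
      using that(2) unfolding z by (simp_all add: vec_eq_iff algebra_simps)
  qed
  have "2 *\<^sub>R b = 2 *\<^sub>R ((b \<bullet> w) *\<^sub>R w + cross3 w a)"
    by (rule *(1)[OF II III])
  then show "b = (b \<bullet> w) *\<^sub>R w + cross3 w a" by simp
  have "2 *\<^sub>R b' = 2 *\<^sub>R ((b \<bullet> w) *\<^sub>R w + cross3 a' w)"
    by (rule *(2)[OF II III])
  then show "b' = (b \<bullet> w) *\<^sub>R w - cross3 w a'"
    using cross_skew[of a' w] by simp
qed

text \<open>The way back from the vector equations. Real numbers are central, so \<open>E0\<close>,
  \<open>B0\<close> and \<open>C0\<close> are arbitrary as long as both vertices share them; this
  freedom later produces a root.\<close>

lemma intertwinesI:
  assumes u: "u \<in> imag_sphere"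
  defines "w \<equiv> qIm u"
  assumes "b' - b = 2 *\<^sub>R cross3 w e"
    and "a \<bullet> w = P" "a' \<bullet> w = P" "b \<bullet> w = Q" "b' \<bullet> w = Q"
    and "b = Q *\<^sub>R w + cross3 w a" "b' = Q *\<^sub>R w - cross3 w a'"
    and "a = P *\<^sub>R w + cross3 b w" "a' = P *\<^sub>R w - cross3 b' w"
  shows "intertwines (Quat E0 e) u (Quat B0 b) (Quat C0 (a + e)) (Quat B0 b') (Quat C0 (a' + e))"
proof -
  have u0: "qRe u = 0" 
    using u by (simp_all add: imag_sphere_iff)
  have 1: "b' + cross3 e w = b + cross3 w e"
    using assms(3) cross_skew[of e w] by (simp add: scaleR_2 algebra_simps)
  have "a' + cross3 b' w = P *\<^sub>R w" using assms(11) by simp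
  moreover have "a + cross3 w b = P *\<^sub>R w" using assms(10) cross_skew[of b w] by simp
  ultimately have 2: "a' + cross3 b' w = a + cross3 w b" by simp
  have "cross3 a' w = b' - Q *\<^sub>R w" using assms(9) cross_skew[of a' w] by simp
  moreover have "cross3 w a = b - Q *\<^sub>R w" using assms(8) by simp
  ultimately have "cross3 a' w - cross3 w a = b' - b" by simp
  also have "\<dots> = cross3 w e - cross3 e w" using 1 by (simp add: algebra_simps)
  finally have 3: "cross3 a' w + cross3 e w = cross3 w a + cross3 w e"
    by (simp add: algebra_simps)
  show ?thesis
    unfolding intertwines_def
    using 1 2 3 assms(4-7)
    by (simp add: quat_eq_iff u0 inner_add_left inner_commute[of w] cross_add_left cross_add_right add_ac flip: w_def)
qed

text \<open>The two relations make \<open>w\<close> and \<open>u'\<close> the conjugates of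
  \<open>v\<close> and \<open>u\<close> by \<open>u - v\<close>, so squares are preserved. The
  conjugating element is nonzero because \<open>u\<close> and \<open>v\<close> have different
  squares.\<close>

lemma baecklund_step:
  fixes u v u' w :: quat
  assumes "u + w = v + u'" "w * u = u' * v" "u * u = -1" "v * v \<noteq> -1"
  shows "u' * u' = -1" "w * w \<noteq> -1"
proof -
  have u': "u' = u + w - v" using assms(1) by (simp add: algebra_simps)
  have ne: "u - v \<noteq> 0" using assms(3,4) by auto
  have c: "w * (u - v) = (u - v) * v"
    using assms(2) unfolding u' by (simp add: algebra_simps)
  have "u' * (u - v) = (u - v) * u"
    using assms(2) unfolding u' by (simp add: algebra_simps)
  then have "u' * u' * (u - v) = (u - v) * (u * u)"
    by (metis mult.assoc)
  then have "u' * u' * (u - v) = -1 * (u - v)" by (simp add: assms(3))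
  then show "u' * u' = -1" using ne by (metis mult_right_cancel)
  have "w * w * (u - v) = (u - v) * (v * v)" using c by (metis mult.assoc)
  then show "w * w \<noteq> -1" 
    using ne assms(4) by (metis mult_left_cancel mult_minus1 mult_minus1_right)
qed

text \<open>Read backwards, \<open>v\<close> is the conjugate of \<open>w\<close> by
  \<open>u + w\<close>, which is nonzero since \<open>w = -u\<close> would have square -1.\<close>

lemma baecklund_step_back:
  fixes u v u' w :: quat
  assumes "u + w = v + u'" "w * u = u' * v" "u * u = -1" "u' * u' = -1" "w * w \<noteq> -1"
  shows "v * v \<noteq> -1"
proof
  assume v: "v * v = -1"
  have ne: "u + w \<noteq> 0"
    using assms(3,5) by (metis add_eq_0_iff minus_mult_minus)
  have "u' * (w * u) * u = u' * (u' * v) * u" by (simp add: assms(2))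
  then have "u' * w * (u * u) = (u' * u') * v * u" by (simp only: mult.assoc)
  then have "u' * w = v * u" by (simp add: assms(3,4))
  then have "v * (u + w) = (v + u') * w" by (simp add: algebra_simps)
  then have "v * v * (u + w) = (u + w) * (w * w)"
    unfolding assms(1)[symmetric] by (metis mult.assoc)
  then show False using v ne assms(5)
    by (metis mult_left_cancel mult_minus1 mult_minus1_right)
qed

section \<open>Transport of a linear right factor across an edge\<close>

text \<open>For \<open>v\<close> of square -4, the equation \<open>B * v = C - 4 *\<^sub>R E\<close>
  says that \<open>v + \<lambda>\<close> is a right factor of
  \<open>E \<lambda>\<^sup>2 + B \<lambda> + C\<close>. Conjugation by \<open>u - v\<close> carries
  it across the edge. The last identity is a Baecklund relation whose new edge is
  \<open>u + w - v\<close>.\<close>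

lemma root_step:
  assumes I: "intertwines E u B C B' C'" and u: "u * u = -1"
    and v: "v * v = (-4) *\<^sub>R 1" and Bv: "B * v = C - 4 *\<^sub>R E"
  shows "\<exists>w. (w * w = (-4) *\<^sub>R 1 \<and> B' * w = C' - 4 *\<^sub>R E) \<and> w * u = (u + w - v) * v"
proof -
  have ne: "u - v \<noteq> 0" using u v by (auto simp: quat_eq_iff)
  define X where "X = u - v"
  define w where "w = X * v * inverse X"
  have wX: "w * X = X * v" using ne by (simp add: w_def X_def mult.assoc)
  have "w * w * X = X * (v * v)" using wX by (metis mult.assoc)
  also have "\<dots> = (-4) *\<^sub>R 1 * X" by (simp add: v)
  finally have ww: "w * w = (-4) *\<^sub>R 1" using ne unfolding X_def by (rule mult_right_cancel[THEN iffD1, rotated])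
  have R1: "B' + E * u = u * E + B" and R2: "C' + B' * u = C + u * B" and R3: "C' * u = u * C"
    using I by (auto simp: intertwines_def)
  \<comment> \<open>Comparing after right multiplication by \<open>X\<close> avoids the inverse in
    \<open>w\<close>; \<open>R2\<close>, \<open>R1\<close> and \<open>R3\<close> each enter
    once.\<close>
  have "B' * w * X = B' * u * v - B' * (v * v)"
    by (simp add: mult.assoc wX) (simp add: X_def algebra_simps)
  also have "B' * u = C + u * B - C'" using R2 by (simp add: algebra_simps)
  also have "(C + u * B - C') * v - B' * (v * v) = C * v + u * (B * v) - C' * v + 4 *\<^sub>R B'"
    by (simp add: v algebra_simps)
  also have "\<dots> = C * v + u * C - 4 *\<^sub>R (u * E) - C' * v + 4 *\<^sub>R B'"
    by (simp add: Bv algebra_simps)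
  also have "4 *\<^sub>R B' = 4 *\<^sub>R (u * E + B - E * u)"
    using R1 by (metis add_diff_cancel_right')
  also have "C * v + u * C - 4 *\<^sub>R (u * E) - C' * v + 4 *\<^sub>R (u * E + B - E * u)
      = C * v + C' * u - C' * v + 4 *\<^sub>R B - 4 *\<^sub>R (E * u)"
    by (simp add: R3 algebra_simps)
  also have "C = B * v + 4 *\<^sub>R E" by (simp add: Bv)
  also have "(B * v + 4 *\<^sub>R E) * v + C' * u - C' * v + 4 *\<^sub>R B - 4 *\<^sub>R (E * u)
     = (C' - 4 *\<^sub>R E) * X"
    by (simp add: X_def mult.assoc v distrib_right) (simp add: algebra_simps)
  finally have "B' * w = C' - 4 *\<^sub>R E" using ne by (simp add: X_def)
  moreover have "w * u = (u + w - v) * v"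
    using wX unfolding X_def by (simp add: algebra_simps)
  ultimately show ?thesis using ww by blast
qed

text \<open>Inverse transport, by conjugation with \<open>u + w\<close>, which is nonzero since
  \<open>u\<close> and \<open>w\<close> have squares -1 and -4.\<close>

lemma root_step_back:
  assumes I: "intertwines E u B C B' C'" and u: "u * u = -1"
    and w: "w * w = (-4) *\<^sub>R 1" and Bw: "B' * w = C' - 4 *\<^sub>R E"
  shows "\<exists>v. (v * v = (-4) *\<^sub>R 1 \<and> B * v = C - 4 *\<^sub>R E) \<and> w * u = (u + w - v) * v"
proof -
  define X where "X = u + w"
  have ne: "X \<noteq> 0"
  proof
    assume "X = 0"
    then have "u = - w" by (simp add: X_def eq_neg_iff_add_eq_0)
    then show False using u w by (simp add: quat_eq_iff)
  qed
  define v where "v = X * w * inverse X"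
  have vX: "v * X = X * w" using ne by (simp add: v_def mult.assoc)
  have "v * v * X = X * (w * w)" using vX by (metis mult.assoc)
  also have "\<dots> = (-4) *\<^sub>R 1 * X" by (simp add: w)
  finally have vv: "v * v = (-4) *\<^sub>R 1" using ne by (rule mult_right_cancel[THEN iffD1, rotated])
  have R1: "B' + E * u = u * E + B" and R2: "C' + B' * u = C + u * B" and R3: "C' * u = u * C"
    using I by (auto simp: intertwines_def)
  have scale: "4 *\<^sub>R q = q + 3 *\<^sub>R q" "16 *\<^sub>R q = 4 *\<^sub>R q + 12 *\<^sub>R q"
    "12 *\<^sub>R q = 3 *\<^sub>R q + 9 *\<^sub>R q" for q :: quat
    using scaleR_left_distrib[of 3 9 q] scaleR_left_distrib[of 1 3 q] scaleR_left_distrib[of 4 12 q] by simp_all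
  \<comment> \<open>\<open>u Z = Z w\<close> with \<open>u\<^sup>2 = -1\<close> and \<open>w\<^sup>2 = -4\<close> kills the defect \<open>Z\<close>.\<close>
  define Z where "Z = (B * v - (C - 4 *\<^sub>R E)) * X"
  have Z: "Z = B * X * w - C * X + 4 *\<^sub>R (E * X)"
    by (simp add: Z_def mult.assoc vX left_diff_distrib)
  have Xw: "X * w * w = (-4) *\<^sub>R X" by (simp add: mult.assoc w)
  have Xs: "X * w = u * w - 4 *\<^sub>R 1" "u * X = u * w - 1" "u * (X * w) = - w - 4 *\<^sub>R u"
    unfolding X_def using u w by (simp_all add: algebra_simps) (simp add: u flip: mult.assoc)
  have "u * Z - Z * w = (u * B + C) * X * w - u * C * X + 4 *\<^sub>R ((u * E + B) * X) - 4 *\<^sub>R (E * X * w)"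
    unfolding Z using Xw by (simp add: algebra_simps)
  also have "\<dots> = (C' + B' * u) * X * w - C' * u * X + 4 *\<^sub>R ((B' + E * u) * X) - 4 *\<^sub>R (E * X * w)"
    by (simp only: R1 R2 R3 add.commute)
  also have "\<dots> = 3 *\<^sub>R (B' * w - C' + 4 *\<^sub>R E)"
    unfolding distrib_right[of C'] mult.assoc Xs
    by (simp add: Xs X_def u w scale algebra_simps)
  finally have uZ: "u * Z = Z * w" by (simp add: Bw)
  have "u * u * Z = Z * (w * w)" using uZ by (metis mult.assoc)
  then have "3 *\<^sub>R Z = 0" by (simp add: u w scaleR_left_diff_distrib[of 4 1 Z, simplified])
  then have "Z = 0" by simp
  then have "B * v = C - 4 *\<^sub>R E" using ne by (simp add: Z_def)
  \<comment> \<open>By definition \<open>v\<close> is \<open>X * w * inverse X\<close>, whereas the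
    Baecklund relation asks for \<open>inverse X * w * X\<close>. These agree because
    \<open>X * X\<close> commutes with \<open>w\<close>.\<close>
  moreover have "X * v = w * X"
  proof -
    have "X * X * w = w * (X * X)"
    proof -
      have XX: "X * X = (-5) *\<^sub>R 1 + u * w + w * u"
        using scaleR_left_distrib[of 1 4 "1 :: quat"] by (simp add: X_def u w algebra_simps)
      moreover have "w * (w * u) = (-4) *\<^sub>R u" by (simp add: w flip: mult.assoc)
      ultimately show ?thesis unfolding XX by (simp add: algebra_simps w)
    qed
    then have "X * v * X = w * X * X" by (simp add: mult.assoc vX)
    then show ?thesis using ne by simp
  qed
  then have "w * u = (u + w - v) * v"
    using vv w by (simp add: X_def algebra_simps)
  ultimately show ?thesis using vv by blast
qed

text \<open>Two one-sided sequences starting at \<open>x\<close> are glued at 0; the one running to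
  the left uses \<open>R\<close> with its arguments reversed.\<close>

lemma dependent_int_choice:
  fixes P :: "int \<Rightarrow> 'a \<Rightarrow> bool"
  assumes base: "P 0 x"
    and fw: "\<And>k x. P k x \<Longrightarrow> \<exists>y. P (k + 1) y \<and> R k x y"
    and bw: "\<And>k y. P (k + 1) y \<Longrightarrow> \<exists>x. P k x \<and> R k x y"
  shows "\<exists>f. f 0 = x \<and> (\<forall>k. P k (f k) \<and> R k (f k) (f (k + 1)))"
proof -
  obtain f where f: "\<And>n. P (int n) (f n) \<and> (n = 0 \<longrightarrow> f n = x)"
      "\<And>n. R (int n) (f n) (f (Suc n))"
    using dependent_nat_choice[of "\<lambda>n y. P (int n) y \<and> (n = 0 \<longrightarrow> y = x)" "\<lambda>n. R (int n)"]
      base fw by (auto simp: add.commute) (metis add.commute)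
  obtain g where g: "\<And>n. P (- int n) (g n) \<and> (n = 0 \<longrightarrow> g n = x)"
      "\<And>n. R (- int (Suc n)) (g (Suc n)) (g n)"
  proof -
    have "\<exists>z. (P (- int (Suc n)) z \<and> (Suc n = 0 \<longrightarrow> z = x)) \<and> R (- int (Suc n)) z y"
      if "P (- int n) y \<and> (n = 0 \<longrightarrow> y = x)" for n y
      using bw[of "- int (Suc n)" y] that by auto
    then show ?thesis
      using dependent_nat_choice[of "\<lambda>n y. P (- int n) y \<and> (n = 0 \<longrightarrow> y = x)"
          "\<lambda>n y z. R (- int (Suc n)) z y"] base that by auto
  qed
  define h where "h k = (if k \<ge> 0 then f (nat k) else g (nat (- k)))" for k
  have "P k (h k) \<and> R k (h k) (h (k + 1))" for k
  proof (cases "k \<ge> 0")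
    case True
    then show ?thesis using f[of "nat k"] by (simp add: h_def nat_add_distrib)
  next
    case False
    define n where "n = nat (- k - 1)"
    have k: "k = - int (Suc n)" using False by (simp add: n_def)
    \<comment> \<open>For \<open>n = 0\<close> the successor index is 0, where \<open>h\<close> is
      read from \<open>f\<close>; both sequences have the value \<open>x\<close> there.\<close>
    have "h (k + 1) = g n" using f(1)[of 0] g(1)[of 0] by (simp add: h_def k)
    moreover have "h k = g (Suc n)" by (simp add: h_def k nat_add_distrib)
    ultimately show ?thesis using g(1)[of "Suc n"] g(2)[of n] by (simp add: k)
  qed
  moreover have "h 0 = x" using f(1)[of 0] by (simp add: h_def)
  ultimately show ?thesis by blast
qed

section \<open>Fitting a root by the choice of real parts\<close>

lemma qnorm_mult:
  "(qRe (p * q))\<^sup>2 + qIm (p * q) \<bullet> qIm (p * q)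
    = ((qRe p)\<^sup>2 + qIm p \<bullet> qIm p) * ((qRe q)\<^sup>2 + qIm q \<bullet> qIm q)"
proof -
  have "cross3 (qIm p) (qIm q) \<bullet> cross3 (qIm p) (qIm q)
      = (qIm p \<bullet> qIm p) * (qIm q \<bullet> qIm q) - (qIm p \<bullet> qIm q)\<^sup>2"
    using norm_cross_dot[of "qIm p" "qIm q"] by (simp add: power_mult_distrib flip: power2_norm_eq_inner)
  then show ?thesis
    by (simp add: inner_add_left inner_add_right dot_cross_self power2_eq_square inner_commute algebra_simps)
qed

text \<open>In the application \<open>b\<close> and \<open>h\<close> are the prescribed imaginary
  parts of \<open>B 0\<close> and \<open>C 0 - 4 *\<^sub>R E\<close>, and only the real parts can be
  adjusted.\<close>

lemma imaginary_root_exists: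
  fixes b h :: "real^3"
  shows "\<exists>B0 H0 v. v * v = (-4) *\<^sub>R 1 \<and> Quat B0 b * v = Quat H0 h"
proof -
  \<comment> \<open>\<open>B v = H\<close> forces \<open>|H|\<^sup>2 = 4 |B|\<^sup>2\<close> and \<open>\<langle>B, H\<rangle> = 0\<close>, the real and imaginary parts of an equation
    for the square of \<open>H0 + 2 \<i> B0\<close>.\<close>
  define z where "z = csqrt (Complex (4 * (b \<bullet> b) - h \<bullet> h) (- 4 * (b \<bullet> h)))"
  define H0 where "H0 = Re z"
  define B0 where "B0 = Im z / 2"
  have "z\<^sup>2 = Complex (4 * (b \<bullet> b) - h \<bullet> h) (- 4 * (b \<bullet> h))" by (simp add: z_def)
  then have z1: "H0\<^sup>2 + h \<bullet> h = 4 * (B0\<^sup>2 + b \<bullet> b)" and z2: "B0 * H0 + b \<bullet> h = 0"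
    by (auto simp: complex_eq_iff H0_def B0_def power2_eq_square)
  let ?B = "Quat B0 b" and ?H = "Quat H0 h"
  show ?thesis
  proof (cases "?B = 0")
    case True
    then have "H0\<^sup>2 + h \<bullet> h = 0" using z1 by (simp add: quat_eq_iff)
    then have "?H = 0" by (simp add: quat_eq_iff add_nonneg_eq_0_iff)
    moreover have "Quat 0 (axis 1 2) * Quat 0 (axis 1 2) = (-4) *\<^sub>R 1"
      by (simp add: quat_eq_iff inner_axis_axis)
    ultimately show ?thesis using True by (metis mult_zero_left)
  next
    case False
    define v where "v = inverse ?B * ?H"
    have Bv: "?B * v = ?H" using False by (simp add: v_def flip: mult.assoc)
    have N: "B0\<^sup>2 + b \<bullet> b \<noteq> 0" using False by (auto simp: quat_eq_iff add_nonneg_eq_0_iff)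
    have H: "H0 = B0 * qRe v - b \<bullet> qIm v" and h: "h = B0 *\<^sub>R qIm v + qRe v *\<^sub>R b + cross3 b (qIm v)"
      using arg_cong[OF Bv, of qRe] arg_cong[OF Bv, of qIm] by simp_all
    \<comment> \<open>The left side is the inner product of \<open>?B\<close> with
      \<open>?B * v\<close>, hence the real part of \<open>v\<close> times the squared norm of
      \<open>?B\<close>.\<close>
    have "B0 * H0 + b \<bullet> h = qRe v * (B0\<^sup>2 + b \<bullet> b)"
      by (subst H, subst h) (simp add: inner_add_right dot_cross_self power2_eq_square algebra_simps)
    then have v0: "qRe v = 0" using z2 N by simp
    have "(B0\<^sup>2 + b \<bullet> b) * (qIm v \<bullet> qIm v) = (B0\<^sup>2 + b \<bullet> b) * 4"
      using qnorm_mult[of ?B v] z1 by (simp add: v0 Bv del: quat_sel)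
    then have "qIm v \<bullet> qIm v = 4" by (rule mult_left_cancel[OF N, THEN iffD1])
    then have "v * v = (-4) *\<^sub>R 1" using v0 by (simp add: quat_eq_iff)
    then show ?thesis using Bv by blast
  qed
qed

section \<open>Pairs of Baecklund transformations as factorisations\<close>

text \<open>Moving \<open>u + \<lambda>\<close> through
  \<open>(q' + \<lambda>)(p' + \<lambda>)\<close> turns it into \<open>u' + \<lambda>\<close>, then
  \<open>u'' + \<lambda>\<close>, and \<open>E\<close> turns \<open>u''\<close> back into
  \<open>u\<close>. The facts \<open>s\<close>, \<open>t\<close>, \<open>w\<close> are the
  coefficients of \<open>\<lambda>\<^sup>2\<close>, \<open>\<lambda>\<close> and 1.\<close>

lemma baecklund_pair_intertwines:
  assumes 1: "baecklund \<gamma> v0 \<gamma>'" and 2: "baecklund \<gamma>' v1 \<gamma>''"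
    and E: "qedge \<gamma> k * E = E * qedge \<gamma>'' k"
  shows "intertwines E (qedge \<gamma> k) (E * (v1 k + v0 k)) (E * (v1 k * v0 k))
    (E * (v1 (k + 1) + v0 (k + 1))) (E * (v1 (k + 1) * v0 (k + 1)))"
proof -
  define u u' u'' where "u = qedge \<gamma> k" "u' = qedge \<gamma>' k" "u'' = qedge \<gamma>'' k"
  define p p' q q' where "p = v0 k" "p' = v0 (k + 1)" "q = v1 k" "q' = v1 (k + 1)"
  note defs = u_u'_u''_def p_p'_q_q'_def
  have r: "u + p' = p + u'" "p' * u = u' * p" "u' + q' = q + u''" "q' * u' = u'' * q"
    using 1 2 by (auto simp: baecklund_def defs)
  have uE: "u * E = E * u''" using E by (simp add: defs)
  have s: "q' + p' + u = u'' + (q + p)" using r(1,3) by (metis add.assoc add.commute)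
  have "q' * p' + (q' + p') * u = q' * (u + p') + p' * u" by (simp add: algebra_simps)
  also have "\<dots> = q' * p + q' * u' + u' * p" by (simp only: r distrib_left)
  also have "\<dots> = (u' + q') * p + u'' * q" by (simp add: r(4) distrib_right)
  also have "\<dots> = q * p + u'' * (q + p)" unfolding r(3) by (simp add: algebra_simps)
  finally have t: "q' * p' + (q' + p') * u = q * p + u'' * (q + p)" .
  have w: "q' * p' * u = u'' * (q * p)" by (metis mult.assoc r(2,4))
  have "E * (q' + p') + E * u = u * E + E * (q + p)"
    using arg_cong[OF s, of "\<lambda>x. E * x"] uE by (simp add: distrib_left)
  moreover have "E * (q' * p') + E * (q' + p') * u = E * (q * p) + u * (E * (q + p))"
  proof -
    have "E * (q' * p') + E * (q' + p') * u = E * (q' * p' + (q' + p') * u)"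
      by (simp only: mult.assoc) (simp only: distrib_left[of E])
    also have "\<dots> = E * (q * p) + E * u'' * (q + p)"
      by (simp only: t mult.assoc) (simp only: distrib_left[of E])
    finally show ?thesis by (simp only: uE[symmetric] mult.assoc)
  qed
  moreover have "E * (q' * p') * u = u * (E * (q * p))"
    using arg_cong[OF w, of "\<lambda>x. E * x"] uE[symmetric] by (simp add: mult.assoc[symmetric])
  ultimately show ?thesis by (simp add: intertwines_def flip: defs)
qed

text \<open>The transported root is \<open>v0\<close>, and dividing it out leaves
  \<open>v1 = inverse E * B - v0\<close>. The edges of \<open>\<gamma>''\<close> are those of
  \<open>\<gamma>\<close> rotated back by \<open>E\<close>.\<close>

lemma baecklund_pair_exists:
  fixes B C :: "int \<Rightarrow> quat"
  assumes u: "\<And>k. qedge \<gamma> k \<in> imag_sphere"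
    and I: "\<And>k. intertwines E (qedge \<gamma> k) (B k) (C k) (B (k + 1)) (C (k + 1))"
    and E: "E \<noteq> 0" and v: "v * v = (-4) *\<^sub>R 1" and Bv: "B 0 * v = C 0 - 4 *\<^sub>R E"
    and nv: "inverse E * B 0 - v \<notin> imag_sphere"
  shows "\<exists>v0 v1 \<gamma>' \<gamma>''. baecklund \<gamma> v0 \<gamma>' \<and> baecklund \<gamma>' v1 \<gamma>'' \<and>
    (\<forall>k. quat_of_vec (\<gamma> k) = E * quat_of_vec (\<gamma>'' k) * inverse E) \<and>
    (\<forall>k. E * (v1 k + v0 k) = B k \<and> E * (v1 k * v0 k) = C k)"
proof -
  have uu: "qedge \<gamma> k * qedge \<gamma> k = -1" for k
    using u[of k] by (simp add: imag_sphere_def power2_eq_square)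
  obtain v0 where v00: "v0 0 = v" and v0: "\<And>k. v0 k * v0 k = (-4) *\<^sub>R 1"
    "\<And>k. B k * v0 k = C k - 4 *\<^sub>R E"
    "\<And>k. v0 (k + 1) * qedge \<gamma> k = (qedge \<gamma> k + v0 (k + 1) - v0 k) * v0 k"
  proof -
    let ?P = "\<lambda>k v. v * v = (-4) *\<^sub>R 1 \<and> B k * v = C k - 4 *\<^sub>R E"
    let ?R = "\<lambda>k v w. w * qedge \<gamma> k = (qedge \<gamma> k + w - v) * v"
    have "\<exists>f. f 0 = v \<and> (\<forall>k. ?P k (f k) \<and> ?R k (f k) (f (k + 1)))"
    proof (rule dependent_int_choice[where P = ?P and R = ?R])
      show "?P 0 v" using v Bv by simp
      show "\<exists>w. ?P (k + 1) w \<and> ?R k v w" if "?P k v" for k v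
        using that by (intro root_step[OF I uu]) simp_all
      show "\<exists>v. ?P k v \<and> ?R k v w" if "?P (k + 1) w" for k w
        using that by (intro root_step_back[OF I uu]) simp_all
    qed
    then show ?thesis using that by (elim exE conjE) metis
  qed
  have v0_ne: "v0 k * v0 k \<noteq> -1" "v0 k \<noteq> 0" for k
    using v0(1)[of k] by (auto simp: quat_eq_iff)
  \<comment> \<open>Half of \<open>v0 k\<close> is an imaginary unit. Hence \<open>v0 k\<close> is
    imaginary, and displacing the vertices of \<open>\<gamma>\<close> by it stays in
    three-space.\<close>
  have Re0: "qRe (v0 k) = 0" for k
  proof -
    have "(1 / 2) *\<^sub>R v0 k \<in> imag_sphere"
      using v0(1)[of k] by (simp add: imag_sphere_def power2_eq_square)
    then show ?thesis by (simp add: imag_sphere_iff)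
  qed
  define v1 where "v1 k = inverse E * B k - v0 k" for k
  have EB: "E * (v1 k + v0 k) = B k" for k
    using E by (simp add: v1_def flip: mult.assoc)
  have EC: "E * (v1 k * v0 k) = C k" for k
  proof -
    have "E * (v1 k * v0 k) = B k * v0 k - E * (v0 k * v0 k)"
      using E by (simp add: v1_def left_diff_distrib right_diff_distrib flip: mult.assoc)
    then show ?thesis by (simp add: v0)
  qed
  define \<gamma>' where "\<gamma>' k = \<gamma> k + qIm (v0 k)" for k
  define \<gamma>'' where "\<gamma>'' k = qIm (inverse E * quat_of_vec (\<gamma> k) * E)" for k
  have u': "qedge \<gamma>' k = qedge \<gamma> k + v0 (k + 1) - v0 k" for k
    by (simp add: quat_eq_iff qedge_def edge_def \<gamma>'_def Re0)
  have Re_conj: "qRe (inverse E * q * E) = qRe q" for q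
  proof -
    have "qRe (inverse E * (q * E)) = qRe ((q * E) * inverse E)"
      by (simp only: quat_sel inner_commute mult.commute)
    also have "\<dots> = qRe q" using E by (simp add: mult.assoc)
    finally show ?thesis by (simp only: mult.assoc)
  qed
  have g'': "quat_of_vec (\<gamma>'' k) = inverse E * quat_of_vec (\<gamma> k) * E" for k
    unfolding quat_eq_iff Re_conj by (simp only: \<gamma>''_def quat_sel)
  have u'': "qedge \<gamma>'' k = inverse E * qedge \<gamma> k * E" for k
  proof -
    have e: "qedge \<eta> k = quat_of_vec (\<eta> (k + 1)) - quat_of_vec (\<eta> k)" for \<eta>
      by (simp add: quat_eq_iff qedge_def edge_def)
    show ?thesis by (simp add: e g'' algebra_simps)
  qed
  have Eu'': "E * qedge \<gamma>'' k = qedge \<gamma> k * E" for k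
    using E by (simp add: u'' flip: mult.assoc)
  have b1: "qedge \<gamma> k + v0 (k + 1) = v0 k + qedge \<gamma>' k"
    "v0 (k + 1) * qedge \<gamma> k = qedge \<gamma>' k * v0 k" for k
    by (simp_all add: u' v0(3))
  have uu': "qedge \<gamma>' k * qedge \<gamma>' k = -1" for k
    by (rule baecklund_step[OF b1 uu v0_ne(1)])
  have b2: "qedge \<gamma>' k + v1 (k + 1) = v1 k + qedge \<gamma>'' k"
    "v1 (k + 1) * qedge \<gamma>' k = qedge \<gamma>'' k * v1 k" for k
  proof -
    have R: "B (k + 1) + E * qedge \<gamma> k = qedge \<gamma> k * E + B k"
      "C (k + 1) * qedge \<gamma> k = qedge \<gamma> k * C k"
      using I[of k] by (auto simp: intertwines_def)
    have "E * (qedge \<gamma>' k + v1 (k + 1)) = E * qedge \<gamma> k + B (k + 1) - E * v0 k"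
      unfolding EB[symmetric] by (simp add: u' algebra_simps)
    also have "\<dots> = E * qedge \<gamma>'' k + B k - E * v0 k"
      using R(1) by (simp add: Eu'' add.commute)
    also have "\<dots> = E * (v1 k + qedge \<gamma>'' k)"
      unfolding EB[symmetric] by (simp add: algebra_simps)
    finally show "qedge \<gamma>' k + v1 (k + 1) = v1 k + qedge \<gamma>'' k" using E by simp
    \<comment> \<open>The product relation is proved with the invertible factors \<open>E\<close> on
      the left and \<open>v0 k\<close> on the right, where it becomes the constant coefficient
      \<open>R(2)\<close>.\<close>
    have "E * (v1 (k + 1) * qedge \<gamma>' k * v0 k) = C (k + 1) * qedge \<gamma> k"
      unfolding EC[symmetric] by (simp only: mult.assoc b1(2)[symmetric])
    also have "\<dots> = qedge \<gamma> k * E * (v1 k * v0 k)"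
      unfolding R(2) unfolding EC[symmetric] by (simp only: mult.assoc)
    also have "\<dots> = E * (qedge \<gamma>'' k * v1 k * v0 k)"
      by (simp only: Eu''[symmetric] mult.assoc)
    finally show "v1 (k + 1) * qedge \<gamma>' k = qedge \<gamma>'' k * v1 k"
      using E v0_ne by simp
  qed
  have uu'': "qedge \<gamma>'' k * qedge \<gamma>'' k = -1" for k
  proof -
    have "E * (qedge \<gamma>'' k * qedge \<gamma>'' k) = E * (-1)"
      by (metis Eu'' mult.assoc uu mult_minus1 mult_minus1_right)
    then show ?thesis using E by (rule mult_left_cancel[THEN iffD1, rotated])
  qed
  \<comment> \<open>Avoiding square -1 at index 0 suffices: the Baecklund relations propagate it in
    both directions.\<close>
  have v1_ne: "v1 k * v1 k \<noteq> -1" for k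
  proof (induction k rule: int_induct[where k = 0])
    case base
    then show ?case using nv by (simp add: v1_def v00 imag_sphere_def power2_eq_square)
  next
    case (step1 i)
    show ?case by (rule baecklund_step(2)[OF b2 uu' step1(2)])
  next
    case (step2 i)
    show ?case
      by (rule baecklund_step_back[OF b2[of "i - 1"] uu' uu'']) (use step2 in simp)
  qed
  have "baecklund \<gamma> v0 \<gamma>'" "baecklund \<gamma>' v1 \<gamma>''"
    unfolding baecklund_def using b1 b2 uu uu' uu'' v0_ne v1_ne
    by (simp_all add: imag_sphere_def power2_eq_square)
  moreover have "quat_of_vec (\<gamma> k) = E * quat_of_vec (\<gamma>'' k) * inverse E" for k
    unfolding g'' using E by (simp add: mult.assoc) (simp flip: mult.assoc)
  ultimately show ?thesis using EB EC by blast
qed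

section \<open>The rod equation at regular vertices\<close>

lemma int_fun_const:
  fixes f :: "int \<Rightarrow> 'a"
  assumes "\<And>k. f (k + 1) = f k"
  shows "f k = f 0"
proof (induction k rule: int_induct[where k = 0])
  case (step2 i)
  then show ?case using assms[of "i - 1"] by simp
qed (simp_all add: assms)

text \<open>This is the vertex formula for \<open>b\<close> with \<open>Q = 2 * \<alpha>\<close> and
  \<open>P = - 2 * \<beta>\<close>.\<close>

lemma tangent_hashimoto_eq:
  "(2 * \<alpha>) *\<^sub>R tangent_flow \<gamma> k + \<beta> *\<^sub>R hashimoto_flow \<gamma> k
    = (1 / (1 + edge \<gamma> (k - 1) \<bullet> edge \<gamma> k)) *\<^sub>R ((2 * \<alpha>) *\<^sub>R (edge \<gamma> (k - 1) + edge \<gamma> k)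
      - (- 2 * \<beta>) *\<^sub>R cross3 (edge \<gamma> (k - 1)) (edge \<gamma> k))"
  by (simp add: tangent_flow_def hashimoto_flow_def algebra_simps)

text \<open>Twice the denominator is the squared length of the sum of the adjacent edges, that is,
  of \<open>\<gamma> (k + 1) - \<gamma> (k - 1)\<close>.\<close>

lemma regular_denominator:
  assumes "arc_length_param \<gamma>" "regular_curve \<gamma>"
  shows "edge \<gamma> k \<bullet> edge \<gamma> k = 1" "1 + edge \<gamma> (k - 1) \<bullet> edge \<gamma> k \<noteq> 0"
    and "qedge \<gamma> k \<in> imag_sphere"
proof -
  have n: "edge \<gamma> j \<bullet> edge \<gamma> j = 1" for j
    using assms(1) by (simp add: arc_length_param_def norm_eq_1)
  then show "edge \<gamma> k \<bullet> edge \<gamma> k = 1" .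
  show "qedge \<gamma> k \<in> imag_sphere"
    using assms(1) by (simp add: imag_sphere_iff qedge_def arc_length_param_def)
  have "edge \<gamma> (k - 1) + edge \<gamma> k \<noteq> 0"
  proof -
    have "edge \<gamma> (k - 1) + edge \<gamma> k = \<gamma> (k + 1) - \<gamma> (k - 1)" by (simp add: edge_def)
    then show ?thesis using assms(2)[unfolded regular_curve_def, rule_format, of k] by simp
  qed
  then have "(edge \<gamma> (k - 1) + edge \<gamma> k) \<bullet> (edge \<gamma> (k - 1) + edge \<gamma> k) \<noteq> 0" by simp
  moreover have "(edge \<gamma> (k - 1) + edge \<gamma> k) \<bullet> (edge \<gamma> (k - 1) + edge \<gamma> k)
      = 2 * (1 + edge \<gamma> (k - 1) \<bullet> edge \<gamma> k)"
    using n by (simp add: inner_add_left inner_add_right inner_commute)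
  ultimately show "1 + edge \<gamma> (k - 1) \<bullet> edge \<gamma> k \<noteq> 0" by simp
qed

section \<open>From two-invariance to the rod equation\<close>

lemma two_invariant_imp_elastic_rod:
  assumes arc: "arc_length_param \<gamma>" "regular_curve \<gamma>" and inv: "two_invariant \<gamma>"
  shows "\<exists>\<alpha> \<beta> e x. (\<alpha>, \<beta>) \<noteq> (0, 0) \<and>
    (\<forall>k. (2 * \<alpha>) *\<^sub>R tangent_flow \<gamma> k + \<beta> *\<^sub>R hashimoto_flow \<gamma> k = cross3 e (\<gamma> k) + x)"
proof -
  obtain v0 v1 \<gamma>' \<gamma>'' E c where bl: "baecklund \<gamma> v0 \<gamma>'" "baecklund \<gamma>' v1 \<gamma>''" and E: "E \<noteq> 0"
    and m: "\<And>k. quat_of_vec (\<gamma> k) = E * quat_of_vec (\<gamma>'' k) * inverse E + quat_of_vec c"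
    and nd: "\<And>k. \<not> acts_as_identity (monodromy E (v1 k) (v0 k))"
    using inv unfolding two_invariant_def by blast
  note unit = regular_denominator(1)[OF arc] and nz = regular_denominator(2)[OF arc]
  have uE: "qedge \<gamma> k * E = E * qedge \<gamma>'' k" for k
  proof -
    have e: "qedge \<eta> k = quat_of_vec (\<eta> (k + 1)) - quat_of_vec (\<eta> k)" for \<eta>
      by (simp add: quat_eq_iff qedge_def edge_def)
    have "qedge \<gamma> k = E * qedge \<gamma>'' k * inverse E"
      unfolding e m[of k] m[of "k + 1"] by (simp add: algebra_simps)
    then show ?thesis using E by (simp add: mult.assoc)
  qed
  define B where "B k = E * (v1 k + v0 k)" for k
  define C where "C k = E * (v1 k * v0 k)" for k
  define a where "a k = qIm (C k - E)" for k
  define b where "b k = qIm (B k)" for k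
  define u where "u k = edge \<gamma> k" for k
  have qu: "qIm (qedge \<gamma> k) = u k" for k by (simp add: qedge_def u_def)
  have I: "intertwines E (qedge \<gamma> k) (B k) (C k) (B (k + 1)) (C (k + 1))" for k
    unfolding B_def C_def by (rule baecklund_pair_intertwines[OF bl uE])
  note vec = intertwines_vec[OF I regular_denominator(3)[OF arc], folded a_def b_def, unfolded qu]
  \<comment> \<open>Vertex \<open>k\<close> sees edge \<open>k\<close> as outgoing and edge
    \<open>k - 1\<close> as incoming, so the incoming formula is \<open>vec(4)\<close> shifted by
    one.\<close>
  have bu: "b k = (b k \<bullet> u k) *\<^sub>R u k + cross3 (u k) (a k)" for k by (rule vec(3))
  have bp: "b k = (b (k - 1) \<bullet> u (k - 1)) *\<^sub>R u (k - 1) - cross3 (u (k - 1)) (a k)" for k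
    using vec(4)[of "k - 1"] by simp
  note vc = vertex_const[OF unit[folded u_def] unit[folded u_def] nz[folded u_def] bu bp]
  define P where "P = a 0 \<bullet> u 0"
  define Q where "Q = b 0 \<bullet> u 0"
  have Q: "b k \<bullet> u k = Q" for k
    unfolding Q_def using int_fun_const[of "\<lambda>k. b k \<bullet> u k"] vc(1)[of "_ + 1"] by simp
  have ap: "a k \<bullet> u (k - 1) = a (k - 1) \<bullet> u (k - 1)" for k
    using vec(1)[of "k - 1"] by simp
  have P: "a k \<bullet> u k = P" for k
    unfolding P_def using int_fun_const[of "\<lambda>k. a k \<bullet> u k"] vc(2)[of "_ + 1"] ap[of "_ + 1"] by simp
  have main: "(1 + u (k - 1) \<bullet> u k) *\<^sub>R b k
      = Q *\<^sub>R (u (k - 1) + u k) - P *\<^sub>R cross3 (u (k - 1)) (u k)" for k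
    by (rule vertex_unique[OF unit[folded u_def] unit[folded u_def] bu[of k, unfolded Q]
          bp[of k, unfolded Q] P]) (simp add: ap P)
  \<comment> \<open>If both constants vanished, \<open>a 0\<close> and \<open>b 0\<close> would
    vanish, and the monodromy at vertex 0 would act as the identity.\<close>
  have PQ: "(P, Q) \<noteq> (0, 0)"
  proof
    assume "(P, Q) = (0, 0)"
    then have "b 0 = 0" using main[of 0] nz[of 0] by (simp add: u_def)
    moreover have "a 0 = 0"
      using bu[of 0] cross_cross_unit(3)[OF unit[folded u_def], of 0 "a 0"] P[of 0]
        \<open>b 0 = 0\<close> \<open>(P, Q) = (0, 0)\<close> by simp
    moreover have "v0 0 \<notin> imag_sphere" using bl(1) by (simp add: baecklund_def)
    ultimately show False
      using nd[of 0] acts_as_identity_monodromy_iff[OF E, of "v0 0" "v1 0"]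
      by (simp add: a_def b_def B_def C_def right_diff_distrib del: quat_sel)
  qed
  \<comment> \<open>With this choice \<open>b (k + 1) - b k\<close> is
    \<open>cross3 e (u k)\<close>, the increment of \<open>cross3 e (\<gamma> k)\<close>.\<close>
  define e where "e = (-2) *\<^sub>R qIm E"
  have "b k - cross3 e (\<gamma> k) = b 0 - cross3 e (\<gamma> 0)" for k
  proof (rule int_fun_const)
    fix k
    have "b (k + 1) - b k = cross3 e (u k)"
      using vec(5)[of k] cross_skew[of "u k" "qIm E"] by (simp add: e_def cross_mult_left)
    also have "\<dots> = cross3 e (\<gamma> (k + 1)) - cross3 e (\<gamma> k)"
      by (simp add: u_def edge_def Cross3.right_diff_distrib)
    finally show "b (k + 1) - cross3 e (\<gamma> (k + 1)) = b k - cross3 e (\<gamma> k)"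
      by (simp add: algebra_simps)
  qed
  then have bk: "b k = cross3 e (\<gamma> k) + (b 0 - cross3 e (\<gamma> 0))" for k
    by (metis add.commute diff_add_cancel)
  have "(2 * (Q / 2)) *\<^sub>R tangent_flow \<gamma> k + (- P / 2) *\<^sub>R hashimoto_flow \<gamma> k = b k" for k
    unfolding tangent_hashimoto_eq using nz[of k, folded u_def]
    by (simp add: main[symmetric] flip: u_def)
  moreover have "(Q / 2, - P / 2) \<noteq> (0, 0)" using PQ by auto
  ultimately show ?thesis using bk by metis
qed

section \<open>From the rod equation to two-invariance\<close>

lemma elastic_rod_imp_two_invariant:
  assumes arc: "arc_length_param \<gamma>" "regular_curve \<gamma>"
    and nz\<alpha>: "(\<alpha>, \<beta>) \<noteq> (0, 0)"
    and rod: "\<And>k. (2 * \<alpha>) *\<^sub>R tangent_flow \<gamma> k + \<beta> *\<^sub>R hashimoto_flow \<gamma> k = cross3 e (\<gamma> k) + x"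
  shows "two_invariant \<gamma>"
proof -
  note unit = regular_denominator(1)[OF arc] and nz = regular_denominator(2)[OF arc]
    and sph = regular_denominator(3)[OF arc]
  define Q where "Q = 2 * \<alpha>"
  define P where "P = - 2 * \<beta>"
  define u where "u k = edge \<gamma> k" for k
  define b where "b k = (1 / (1 + u (k - 1) \<bullet> u k)) *\<^sub>R
      (Q *\<^sub>R (u (k - 1) + u k) - P *\<^sub>R cross3 (u (k - 1)) (u k))" for k
  define a where "a k = (1 / (1 + u (k - 1) \<bullet> u k)) *\<^sub>R
      (P *\<^sub>R (u (k - 1) + u k) + Q *\<^sub>R cross3 (u (k - 1)) (u k))" for k
  have qu: "qIm (qedge \<gamma> k) = u k" for k by (simp add: qedge_def u_def)
  note vx = vertex_exists[OF unit[folded u_def] unit[folded u_def] nz[folded u_def],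
      where P = P and Q = Q, folded a_def b_def]
  note vp = vx(2,4,6,8)[of "k + 1" for k, unfolded add_diff_cancel_right']
  have b: "b k = cross3 e (\<gamma> k) + x" for k
    using rod[of k] unfolding tangent_hashimoto_eq by (simp add: b_def P_def Q_def u_def)
  \<comment> \<open>The imaginary part of \<open>E\<close>, forced by comparing the increment of the
    rod equation with \<open>2 *\<^sub>R cross3 (u k) f\<close>.\<close>
  define f where "f = (- 1 / 2) *\<^sub>R e"
  have db: "b (k + 1) - b k = 2 *\<^sub>R cross3 (u k) f" for k
  proof -
    have "b (k + 1) - b k = cross3 e (u k)"
      by (simp add: b u_def edge_def Cross3.right_diff_distrib)
    then show ?thesis using cross_skew[of e "u k"] by (simp add: f_def cross_mult_right)
  qed
  obtain B0 H0 v where v: "v * v = (-4) *\<^sub>R 1" "Quat B0 (b 0) * v = Quat H0 (a 0 - 3 *\<^sub>R f)"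
    using imaginary_root_exists by blast
  define N where "N = B0\<^sup>2 + b 0 \<bullet> b 0"
  have N: "N \<ge> 0" by (simp add: N_def)
  define E where "E = Quat (1 + N) f"
  \<comment> \<open>This makes \<open>H0\<close> the real part of
    \<open>C 0 - 4 *\<^sub>R E\<close>; \<open>E\<close> depends on \<open>B0\<close> only through
    \<open>N\<close>, so the choices are not circular.\<close>
  define C0 where "C0 = H0 + 4 * (1 + N)"
  define B where "B k = Quat B0 (b k)" for k
  define C where "C k = Quat C0 (a k + f)" for k
  have E: "E \<noteq> 0" using N by (auto simp: E_def quat_eq_iff)
  have I: "intertwines E (qedge \<gamma> k) (B k) (C k) (B (k + 1)) (C (k + 1))" for k
    unfolding E_def B_def C_def
    by (rule intertwinesI[OF sph, where P = P and Q = Q, unfolded qu]) (fact db vx(1,3,5,7) vp)+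
  have Bv: "B 0 * v = C 0 - 4 *\<^sub>R E"
  proof -
    have "C 0 - 4 *\<^sub>R E = Quat H0 (a 0 - 3 *\<^sub>R f)"
      using scaleR_left_distrib[of 1 3 f] by (simp add: C_def E_def C0_def quat_eq_iff)
    then show ?thesis using v(2) by (simp add: B_def)
  qed
  \<comment> \<open>Since \<open>v\<close> has norm 2, a difference on the unit sphere would give
    \<open>X\<close> norm at least 1. Then \<open>N\<close>, the squared norm of
    \<open>E * X\<close>, would be at least \<open>(1 + N)\<^sup>2\<close>.\<close>
  have nv: "inverse E * B 0 - v \<notin> imag_sphere"
  proof
    define X where "X = inverse E * B 0"
    assume "inverse E * B 0 - v \<in> imag_sphere"
    then have 1: "norm (qIm X - qIm v) = 1" by (simp add: imag_sphere_iff X_def)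
    have "(1 / 2) *\<^sub>R v \<in> imag_sphere"
      using v(1) by (simp add: imag_sphere_def power2_eq_square)
    then have "norm (qIm v) = 2" by (simp add: imag_sphere_iff)
    then have "norm (qIm X) \<ge> 1" using 1 norm_triangle_ineq2[of "qIm v" "qIm X"]
      by (simp add: norm_minus_commute)
    then have X: "qIm X \<bullet> qIm X \<ge> 1"
      by (simp add: norm_ge_square)
    have EX: "E * X = B 0" using E by (simp add: X_def flip: mult.assoc)
    have "((1 + N)\<^sup>2 + f \<bullet> f) * ((qRe X)\<^sup>2 + qIm X \<bullet> qIm X) = N"
      using qnorm_mult[of E X] unfolding EX by (simp add: E_def B_def N_def)
    moreover have "((1 + N)\<^sup>2 + f \<bullet> f) * ((qRe X)\<^sup>2 + qIm X \<bullet> qIm X) \<ge> (1 + N)\<^sup>2 * 1"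
      using X zero_le_power2[of "qRe X"] by (intro mult_mono) (simp, linarith, simp_all)
    moreover have "(1 + N)\<^sup>2 \<ge> 1 + N" using N by (simp add: power2_eq_square algebra_simps)
    ultimately show False by simp
  qed
  obtain v0 v1 \<gamma>' \<gamma>'' where bl: "baecklund \<gamma> v0 \<gamma>'" "baecklund \<gamma>' v1 \<gamma>''"
    and mot: "\<And>k. quat_of_vec (\<gamma> k) = E * quat_of_vec (\<gamma>'' k) * inverse E"
    and BC: "\<And>k. E * (v1 k + v0 k) = B k" "\<And>k. E * (v1 k * v0 k) = C k"
    using baecklund_pair_exists[OF sph I E v(1) Bv nv] by blast
  have "\<not> acts_as_identity (monodromy E (v1 k) (v0 k))" for k
  proof
    assume "acts_as_identity (monodromy E (v1 k) (v0 k))"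
    moreover have "v0 k \<notin> imag_sphere" using bl(1) by (simp add: baecklund_def)
    ultimately have "qIm (C k - E) = 0" "qIm (B k) = 0"
      using acts_as_identity_monodromy_iff[OF E, of "v0 k" "v1 k"]
      by (simp_all add: BC right_diff_distrib del: quat_sel)
    then have "a k = 0" "b k = 0" by (simp_all add: B_def C_def E_def)
    then show False using vx(1,3)[of k] nz\<alpha> by (simp add: P_def Q_def)
  qed
  then show ?thesis
    unfolding two_invariant_def using bl E mot
    by (intro exI[of _ v0] exI[of _ v1] exI[of _ \<gamma>'] exI[of _ \<gamma>''] exI[of _ E] exI[of _ 0])
      (simp add: quat_of_vec_def flip: zero_quat_def)
qed

theorem theorem3p9:
  fixes \<gamma> :: "int \<Rightarrow> real^3"
  assumes "arc_length_param \<gamma>" and "regular_curve \<gamma>"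
  shows "two_invariant \<gamma> \<longleftrightarrow>
    (\<exists>(\<alpha>::real) (\<beta>::real) (e::real^3) (x::real^3).
       (\<alpha>, \<beta>) \<noteq> (0, 0) \<and>
       (\<forall>k. (2 * \<alpha>) *\<^sub>R tangent_flow \<gamma> k + \<beta> *\<^sub>R hashimoto_flow \<gamma> k
            = cross3 e (\<gamma> k) + x))"
  using two_invariant_imp_elastic_rod[OF assms] elastic_rod_imp_two_invariant[OF assms]
  by blast

end
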